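(* Let $N\geq n\geq 2$ be integers, let $w=(w_1,\dots,w_n)\in\mathbb{R}^n$ be a fixed vector, and let $X_1,\dots,X_N\in[-1,1]$ be exchangeable random variables. Let $\bar X=\frac1N\sum_{i=1}^N X_i$, $H_N=1+\frac12+\dots+\frac1N$ and $\epsilon_N=\frac{H_N-1}{N-H_N}$. Then for any $\lambda\in\mathbb{R}$, \[\mathbb{E}\left[\exp\left\{\lambda\sum_{i=1}^n w_i(X_i-\bar X)\right\}\right]\leq \exp\left\{\frac{\lambda^2}{2}\|w\|_2^2\cdot(1+\epsilon_N)\right\}.\] Consequently, for any $\delta\in(0,1)$, \[\mathbb{P}\left\{\sum_{i=1}^n w_i(X_i-\bar X)\geq \|w\|_2\sqrt{2(1+\epsilon_N)\cdot\log(1/\delta)}\right\}\leq\delta.\]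
   Context: Random variables $X_1,\dots,X_N$ are exchangeable if the joint distribution of $(X_1,\dots,X_N)$ equals that of $(X_{\pi(1)},\dots,X_{\pi(N)})$ for every permutation $\pi$ of $\{1,\dots,N\}$. $\|w\|_2=(\sum_{i=1}^n w_i^2)^{1/2}$ is the Euclidean norm. Note that $\bar X$ is the mean of all $N$ variables (not only the first $n$), and is itself random.
   Formalization: The tail bound is stated only for nonzero w: for w = 0 the event is {0 ≥ 0}, which has probability 1 > δ, so the printed claim fails there; the moment generating function bound is for every w. *)

theory Defs
  imports "HOL-Probability.Probability" "HOL-Combinatorics.Permutations"
begin

text \<open>
  Equality of joint laws. This is meant for families of measurable functions: the value of
  \<^const>\<open>distr\<close> at a non-measurable function carries no information, so measurability of
  each \<open>X i\<close> with \<open>i \<in> {1..N}\<close> has to be assumed alongside.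
\<close>

definition exchangeable :: "'a measure \<Rightarrow> nat \<Rightarrow> (nat \<Rightarrow> 'a \<Rightarrow> real) \<Rightarrow> bool" where
  "exchangeable M N X \<longleftrightarrow>
     (\<forall>\<pi>. \<pi> permutes {1..N} \<longrightarrow>
        distr M (\<Pi>\<^sub>M i\<in>{1..N}. borel) (\<lambda>\<omega>. \<lambda>i\<in>{1..N}. X i \<omega>) =
        distr M (\<Pi>\<^sub>M i\<in>{1..N}. borel) (\<lambda>\<omega>. \<lambda>i\<in>{1..N}. X (\<pi> i) \<omega>))"

definition sample_mean :: "nat \<Rightarrow> (nat \<Rightarrow> 'a \<Rightarrow> real) \<Rightarrow> 'a \<Rightarrow> real" where
  "sample_mean N X \<omega> = (\<Sum>i=1..N. X i \<omega>) / real N"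

text \<open>Here \<open>harm N\<close> is the harmonic number; the denominator is positive for \<open>N \<ge> 2\<close>.\<close>

definition epsilon :: "nat \<Rightarrow> real" where
  "epsilon N = (harm N - 1) / (real N - harm N)"

end

theory Submission
  imports Defs "HOL-Combinatorics.Multiset_Permutations"
begin

text \<open>
  Write \<open>C\<close> for \<open>1 + \<epsilon>\<^sub>N = (N - 1) / (N - H\<^sub>N)\<close>. Fix an enumeration \<open>\<sigma>\<close> of the indices
  and, for a vector \<open>u\<close>, form its innovations along \<open>\<sigma>\<close>: the differences between an entry and
  the mean of this entry together with all entries that come later in \<open>\<sigma>\<close>. The proof rests on
  two facts about them.

  The first is a martingale bound. Along a fixed \<open>\<sigma>\<close>, the innovations of the exchangeable
  variables \<open>X\<close> are martingale differences of conditional range at most 2: when the multiset of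
  values left over is known, the next entry is uniformly distributed on it. So Hoeffding's lemma,
  applied one step at a time, gives \<open>E exp (v \<bullet> innovations X \<sigma>) \<le> exp (\<parallel>v\<parallel>\<^sup>2 / 2)\<close> for every
  fixed vector \<open>v\<close> (\<open>expectation_exp_innovations_le\<close>; the combinatorial core is
  \<open>sum_permutations_exp_innovations_le\<close>).

  The second is an averaging identity (\<open>sum_permutations_innovations\<close>): if \<open>\<sigma>\<close> ranges over all
  enumerations, the mean of \<open>innovations w \<sigma> \<bullet> innovations x \<sigma>\<close> is
  \<open>\<Sum>\<^sub>i (w\<^sub>i - mean w) (x\<^sub>i - mean x) / C\<close>. Hence \<open>\<Sum>\<^sub>i w\<^sub>i (X\<^sub>i - mean X)\<close> is the average over
  \<open>\<sigma>\<close> of \<open>C * (innovations w \<sigma> \<bullet> innovations X \<sigma>)\<close>.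

  By convexity of \<open>exp\<close>, the exponents of the martingale bounds for the individual \<open>\<sigma>\<close> may be
  averaged. They are \<open>C\<^sup>2 * \<parallel>innovations w \<sigma>\<parallel>\<^sup>2 / 2\<close>, and by the averaging identity, now with
  \<open>x = w\<close>, their mean is \<open>C * \<parallel>w - mean w\<parallel>\<^sup>2 / 2 \<le> C * \<parallel>w\<parallel>\<^sup>2 / 2\<close>: only one of the two factors
  \<open>C\<close> survives. The average over \<open>\<sigma>\<close> is what produces this constant. For a single \<open>\<sigma>\<close> the sum
  \<open>\<Sum>\<^sub>i w\<^sub>i (X\<^sub>i - mean X)\<close> is itself a pairing of the innovations of \<open>X\<close> with a fixed vector, but
  the squared norm of that vector, on average over \<open>\<sigma>\<close>, replaces \<open>C\<close> by the arithmetic mean of the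
  numbers \<open>j / (j - 1)\<close> for \<open>2 \<le> j \<le> N\<close>, whereas \<open>C\<close> is their harmonic mean. The tail bound follows by Chernoff's method.
\<close>

section \<open>Deviations from the mean over a finite set\<close>

definition centred :: "'i set \<Rightarrow> ('i \<Rightarrow> real) \<Rightarrow> 'i \<Rightarrow> real" where
  "centred A x i = x i - (\<Sum>k\<in>A. x k) / real (card A)"

lemma centred_cong: "(\<And>k. k \<in> A \<Longrightarrow> x k = y k) \<Longrightarrow> x i = y i \<Longrightarrow> centred A x i = centred A y i"
  by (simp add: centred_def cong: sum.cong)

lemma sum_centred_eq_0: "finite A \<Longrightarrow> (\<Sum>i\<in>A. centred A x i) = 0"
  by (cases "A = {}") (auto simp: centred_def sum_subtractf)

lemma centred_image:
  assumes "inj \<pi>"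
  shows "centred (\<pi> ` A) x (\<pi> i) = centred A (x \<circ> \<pi>) i"
proof -
  have inj: "inj_on \<pi> A"
    using assms by (rule inj_on_subset) simp
  show ?thesis
    by (simp add: centred_def sum.reindex[OF inj] card_image[OF inj])
qed

lemma abs_mean_le:
  fixes x :: "'i \<Rightarrow> real"
  assumes "finite A" "A \<noteq> {}" "\<And>i. i \<in> A \<Longrightarrow> \<bar>x i\<bar> \<le> c"
  shows "\<bar>(\<Sum>i\<in>A. x i) / real (card A)\<bar> \<le> c"
proof -
  have "\<bar>\<Sum>i\<in>A. x i\<bar> \<le> (\<Sum>i\<in>A. \<bar>x i\<bar>)" by (rule sum_abs)
  also have "\<dots> \<le> real (card A) * c" using assms(3) by (rule sum_bounded_above)
  finally show ?thesis
    using assms(1,2) by (simp add: divide_le_eq card_gt_0_iff mult.commute)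
qed

lemma sum_centred_mult:
  assumes "finite A"
  shows "(\<Sum>i\<in>A. centred A w i * centred A x i) =
    (\<Sum>i\<in>A. w i * x i) - (\<Sum>i\<in>A. w i) * (\<Sum>i\<in>A. x i) / real (card A)"
proof -
  define m where "m = (\<Sum>i\<in>A. w i) / real (card A)"
  have "(\<Sum>i\<in>A. centred A w i * centred A x i) =
      (\<Sum>i\<in>A. w i * centred A x i) - m * (\<Sum>i\<in>A. centred A x i)"
    by (simp add: centred_def[of A w] m_def[symmetric] left_diff_distrib sum_subtractf sum_distrib_left)
  also have "\<dots> = (\<Sum>i\<in>A. w i * centred A x i)"
    using assms by (simp add: sum_centred_eq_0)
  also have "\<dots> = (\<Sum>i\<in>A. w i * x i) - (\<Sum>i\<in>A. w i) * (\<Sum>i\<in>A. x i) / real (card A)"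
    by (simp add: centred_def right_diff_distrib sum_subtractf sum_distrib_right[symmetric] sum_divide_distrib[symmetric])
  finally show ?thesis .
qed

lemma sum_mult_centred:
  assumes "finite A"
  shows "(\<Sum>i\<in>A. w i * centred A x i) = (\<Sum>i\<in>A. centred A w i * centred A x i)"
  by (simp add: sum_centred_mult[OF assms])
    (simp add: centred_def right_diff_distrib sum_subtractf sum_distrib_right[symmetric] sum_divide_distrib[symmetric])

lemma sum_centred_square_le:
  assumes "finite A"
  shows "(\<Sum>i\<in>A. (centred A w i)\<^sup>2) \<le> (\<Sum>i\<in>A. (w i)\<^sup>2)"
  using sum_centred_mult[OF assms, of w w] by (simp add: power2_eq_square)

text \<open>
  The update formula for the covariance when one observation is deleted. It drives the induction
  behind the averaging identity.
\<close>

lemma sum_centred_mult_remove: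
  assumes "finite A" "i \<in> A" "2 \<le> card A"
  shows "(\<Sum>k\<in>A - {i}. centred (A - {i}) w k * centred (A - {i}) x k) =
    (\<Sum>k\<in>A. centred A w k * centred A x k)
      - real (card A) / (real (card A) - 1) * (centred A w i * centred A x i)"
proof -
  define n where "n = real (card A)"
  have n: "n \<ge> 2" "real (card (A - {i})) = n - 1"
    using assms by (auto simp: n_def of_nat_diff)
  have rem: "(\<Sum>k\<in>A - {i}. f k) = (\<Sum>k\<in>A. f k) - f i" for f :: "'a \<Rightarrow> real"
    using assms by (simp add: sum_diff1)
  show ?thesis
    using n(1) assms(1) unfolding sum_centred_mult[OF assms(1)]
    by (subst sum_centred_mult) (simp_all add: rem n(2) centred_def n_def[symmetric] divide_simps, 
        simp add: algebra_simps)
qed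

section \<open>Innovations along an enumeration\<close>

text \<open>
  Reading the list from its end, this is the sequence of differences between a new observation
  and the running mean that includes it. Reading it from its head, each term is the deviation of
  a sample drawn without replacement from the mean of what was left, hence a martingale difference
  under a random enumeration.
\<close>

primrec innovations :: "('i \<Rightarrow> real) \<Rightarrow> 'i list \<Rightarrow> real list" where
  "innovations x [] = []"
| "innovations x (i # is) = centred (set (i # is)) x i # innovations x is"

definition dot :: "real list \<Rightarrow> real list \<Rightarrow> real" where
  "dot vs ys = sum_list (map2 (*) vs ys)"

lemma dot_simps [simp]:
  "dot [] ys = 0" "dot vs [] = 0" "dot (v # vs) (y # ys) = v * y + dot vs ys"
  by (simp_all add: dot_def)

lemma dot_map_mult_left: "dot (map ((*) c) vs) ys = c * dot vs ys"
  by (induction vs ys rule: list_induct2') (auto simp: algebra_simps)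

lemma dot_map_mult_self: "dot (map ((*) c) vs) (map ((*) c) vs) = c\<^sup>2 * dot vs vs"
  by (induction vs) (auto simp: algebra_simps power2_eq_square)

lemma length_innovations [simp]: "length (innovations x is) = length is"
  by (induction "is") auto

lemma innovations_cong:
  "(\<And>i. i \<in> set is \<Longrightarrow> x i = y i) \<Longrightarrow> innovations x is = innovations y is"
  by (induction "is") (auto intro!: centred_cong)

lemma innovations_map:
  assumes "inj \<pi>"
  shows "innovations x (map \<pi> is) = innovations (x \<circ> \<pi>) is"
proof (induction "is")
  case (Cons i js)
  then show ?case
    using centred_image[OF assms, of "set (i # js)" x i] by (simp add: o_def)
qed simp

lemma borel_measurable_dot_innovations:
  assumes "\<And>i. i \<in> set is \<Longrightarrow> (\<lambda>\<omega>. Z \<omega> i) \<in> borel_measurable M"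
  shows "(\<lambda>\<omega>. dot vs (innovations (Z \<omega>) is)) \<in> borel_measurable M"
  using assms
proof (induction "is" arbitrary: vs)
  case (Cons i js)
  have "(\<lambda>\<omega>. centred (set (i # js)) (Z \<omega>) i) \<in> borel_measurable M"
    unfolding centred_def
    by (intro borel_measurable_diff borel_measurable_divide borel_measurable_sum
        borel_measurable_const Cons.prems) auto
  then show ?case
    using Cons by (cases vs) auto
qed simp

lemma abs_dot_innovations_le:
  assumes "\<And>i. i \<in> set is \<Longrightarrow> \<bar>x i\<bar> \<le> 1"
  shows "\<bar>dot vs (innovations x is)\<bar> \<le> 2 * (\<Sum>v\<leftarrow>vs. \<bar>v\<bar>)"
  using assms
proof (induction "is" arbitrary: vs)
  case Nil
  have "0 \<le> (\<Sum>v\<leftarrow>vs. \<bar>v\<bar>)" by (rule sum_list_nonneg) auto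
  then show ?case by simp
next
  case (Cons i js)
  show ?case
  proof (cases vs)
    case (Cons v us)
    have "\<bar>x i\<bar> \<le> 1" using Cons.prems by simp
    moreover have "\<bar>(\<Sum>k\<in>set (i # js). x k) / real (card (set (i # js)))\<bar> \<le> 1"
      by (rule abs_mean_le) (use Cons.prems in auto)
    ultimately have c: "\<bar>centred (set (i # js)) x i\<bar> \<le> 2"
      unfolding centred_def by linarith
    have head: "\<bar>v * centred (set (i # js)) x i\<bar> \<le> 2 * \<bar>v\<bar>"
      unfolding abs_mult mult.commute[of 2] by (rule mult_left_mono[OF c]) simp
    have tail: "\<bar>dot us (innovations x js)\<bar> \<le> 2 * (\<Sum>v\<leftarrow>us. \<bar>v\<bar>)"
      by (rule Cons.IH) (use Cons.prems in auto)
    show ?thesis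
      unfolding Cons innovations.simps dot_simps list.map sum_list.Cons distrib_left
      by (rule order_trans[OF abs_triangle_ineq add_mono[OF head tail]])
  qed (simp add: sum_list_nonneg)
qed

section \<open>The martingale bound\<close>

lemma sum_permutations_of_set_Cons:
  fixes f :: "'i list \<Rightarrow> real"
  assumes "finite A" "A \<noteq> {}"
  shows "(\<Sum>is\<in>permutations_of_set A. f is) =
    (\<Sum>i\<in>A. \<Sum>is\<in>permutations_of_set (A - {i}). f (i # is))"
proof -
  have "(\<Sum>is\<in>permutations_of_set A. f is) =
      (\<Sum>i\<in>A. \<Sum>is\<in>(#) i ` permutations_of_set (A - {i}). f is)"
    unfolding permutations_of_set_nonempty[OF assms(2)]
    by (rule sum.UNION_disjoint) (use assms in auto)
  also have "\<dots> = (\<Sum>i\<in>A. \<Sum>is\<in>permutations_of_set (A - {i}). f (i # is))"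
    by (rule sum.cong[OF refl], subst sum.reindex) auto
  finally show ?thesis .
qed

lemma sum_exp_centred_le:
  assumes "finite A" "A \<noteq> {}" "\<And>i. i \<in> A \<Longrightarrow> \<bar>x i\<bar> \<le> 1"
  shows "(\<Sum>i\<in>A. exp (l * centred A x i)) \<le> real (card A) * exp (l\<^sup>2 / 2)"
proof -
  have pos: "(\<Sum>i\<in>A. exp (l * centred A x i)) \<le> real (card A) * exp (l\<^sup>2 / 2)"
    if l: "l > 0" and x: "\<And>i. i \<in> A \<Longrightarrow> \<bar>x i\<bar> \<le> 1" for l and x :: "'a \<Rightarrow> real"
  proof -
    define p where "p = measure_pmf (pmf_of_set A)"
    interpret p: prob_space p
      unfolding p_def by (rule prob_space_measure_pmf)
    have card: "real (card A) > 0" using assms by (simp add: card_gt_0_iff)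
    have "AE i in p. x i \<in> {-1..1}"
      unfolding p_def AE_measure_pmf_iff
      using x assms(1,2) by (auto simp: abs_le_iff minus_le_iff)
    then interpret p: interval_bounded_random_variable p x "-1" 1
      by unfold_locales (simp_all add: p_def)
    have mean: "p.expectation x = (\<Sum>k\<in>A. x k) / real (card A)"
      using assms by (simp add: p_def integral_pmf_of_set)
    have "(\<integral>\<^sup>+i. exp (l * centred A x i) \<partial>p) \<le> exp (l\<^sup>2 / 2)"
      using p.Hoeffdings_lemma_nn_integral[OF l] by (simp add: centred_def mean)
    moreover have "(\<integral>\<^sup>+i. exp (l * centred A x i) \<partial>p) =
        ennreal (p.expectation (\<lambda>i. exp (l * centred A x i)))"
      unfolding p_def using assms(1,2)
      by (intro nn_integral_eq_integral integrable_measure_pmf_finite) auto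
    ultimately have "p.expectation (\<lambda>i. exp (l * centred A x i)) \<le> exp (l\<^sup>2 / 2)"
      by simp
    moreover have "p.expectation (\<lambda>i. exp (l * centred A x i)) =
        (\<Sum>i\<in>A. exp (l * centred A x i)) / real (card A)"
      using assms by (simp add: p_def integral_pmf_of_set)
    ultimately show ?thesis
      using card by (simp add: divide_le_eq mult.commute)
  qed
  consider "l = 0" | "l > 0" | "l < 0" by linarith
  then show ?thesis
  proof cases
    case 3
    have "centred A (\<lambda>k. - x k) i = - centred A x i" for i
      by (simp add: centred_def sum_negf)
    then show ?thesis
      using pos[of "-l" "\<lambda>k. - x k"] 3 assms(3) by simp
  qed (use pos assms(3) in auto)
qed

text \<open>
  Conditionally on the first entry of a uniformly random enumeration, the remaining list is a
  uniformly random enumeration of the rest. Its innovations do not involve the first entry, so the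
  bound for the rest is a constant factor and Hoeffding's lemma takes care of the first entry.
\<close>

lemma sum_permutations_exp_innovations_le:
  assumes "finite A" "length vs = card A" "\<And>i. i \<in> A \<Longrightarrow> \<bar>x i\<bar> \<le> 1"
  shows "(\<Sum>is\<in>permutations_of_set A. exp (dot vs (innovations x is)))
    \<le> fact (card A) * exp (dot vs vs / 2)"
  using assms
proof (induction vs arbitrary: A)
  case Nil
  then show ?case by simp
next
  case (Cons v vs)
  then have ne: "A \<noteq> {}" by auto
  have "(\<Sum>is\<in>permutations_of_set A. exp (dot (v # vs) (innovations x is))) =
      (\<Sum>i\<in>A. exp (v * centred A x i) *
        (\<Sum>is\<in>permutations_of_set (A - {i}). exp (dot vs (innovations x is))))"
    unfolding sum_permutations_of_set_Cons[OF Cons.prems(1) ne] sum_distrib_left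
    by (intro sum.cong refl)
      (auto simp: exp_add insert_absorb dest: permutations_of_setD)
  also have "\<dots> \<le> (\<Sum>i\<in>A. exp (v * centred A x i) * (fact (card A - 1) * exp (dot vs vs / 2)))"
  proof (intro sum_mono mult_left_mono)
    fix i assume "i \<in> A"
    then show "(\<Sum>is\<in>permutations_of_set (A - {i}). exp (dot vs (innovations x is)))
        \<le> fact (card A - 1) * exp (dot vs vs / 2)"
      using Cons.IH[of "A - {i}"] Cons.prems by simp
  qed simp
  also have "\<dots> = (\<Sum>i\<in>A. exp (v * centred A x i)) * (fact (card A - 1) * exp (dot vs vs / 2))"
    by (simp add: sum_distrib_right)
  also have "\<dots> \<le> (real (card A) * exp (v\<^sup>2 / 2)) * (fact (card A - 1) * exp (dot vs vs / 2))"
    by (intro mult_right_mono sum_exp_centred_le) (use Cons.prems ne in auto)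
  also have "\<dots> = fact (card A) * exp (dot (v # vs) (v # vs) / 2)"
    using Cons.prems ne
    by (simp add: fact_reduce[of "card A"] card_gt_0_iff exp_add add_divide_distrib power2_eq_square)
  finally show ?case .
qed

section \<open>The averaging identity\<close>

text \<open>
  In a uniformly random enumeration, the last \<open>j\<close> entries form a uniformly random subset of size
  \<open>j\<close>, and the term that belongs to them averages to \<open>1 - 1/j\<close> times the unbiased sample
  covariance, which is where \<open>N - 1\<close> comes from. Summing \<open>1 - 1/j\<close> over \<open>j \<le> N\<close> gives \<open>N - harm N\<close>.
  The induction removes the head of the enumeration and uses \<open>sum_centred_mult_remove\<close>.
\<close>

lemma sum_permutations_innovations:
  assumes "finite A" "card A = N" "N \<noteq> 0"
  shows "(real N - 1) * (\<Sum>is\<in>permutations_of_set A. dot (innovations w is) (innovations x is)) =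
    fact N * (real N - harm N) * (\<Sum>i\<in>A. centred A w i * centred A x i)"
  using assms
proof (induction N arbitrary: A)
  case (Suc n)
  define K where "K = (\<Sum>i\<in>A. centred A w i * centred A x i)"
  define R where
    "R i = (\<Sum>is\<in>permutations_of_set (A - {i}). dot (innovations w is) (innovations x is))" for i
  have ne: "A \<noteq> {}" using Suc.prems by auto
  show ?case
  proof (cases "n = 0")
    case True
    then have "harm (Suc n) = (1 :: real)" by (simp add: harm_def)
    then show ?thesis using True by simp
  next
    case n: False
    have "(\<Sum>is\<in>permutations_of_set A. dot (innovations w is) (innovations x is)) =
        (\<Sum>i\<in>A. fact n * (centred A w i * centred A x i) + R i)"
      unfolding sum_permutations_of_set_Cons[OF Suc.prems(1) ne] R_def
      using Suc.prems
      by (intro sum.cong refl)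
        (simp add: sum.distrib insert_absorb permutations_of_setD(1) cong: sum.cong)
    then have rec: "(\<Sum>is\<in>permutations_of_set A. dot (innovations w is) (innovations x is)) =
        fact n * K + (\<Sum>i\<in>A. R i)"
      by (simp add: sum.distrib sum_distrib_left K_def)
    have "(real n - 1) * R i =
        fact n * (real n - harm n) *
          (K - real (Suc n) / real n * (centred A w i * centred A x i))" if "i \<in> A" for i
      using Suc.IH[of "A - {i}"] Suc.prems that n
      by (simp add: R_def K_def sum_centred_mult_remove)
    then have "(real n - 1) * (\<Sum>i\<in>A. R i) =
        (\<Sum>i\<in>A. fact n * (real n - harm n) *
          (K - real (Suc n) / real n * (centred A w i * centred A x i)))"
      by (simp add: sum_distrib_left)
    also have "\<dots> = fact n * (real n - harm n) *
        (real (Suc n) * K - real (Suc n) / real n * K)"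
      using Suc.prems(2)
      by (simp only: sum_distrib_left[symmetric] sum_subtractf sum_constant K_def[symmetric])
    also have "\<dots> = (real n - 1) *
        (fact n * (real n - harm n) * (real (Suc n) / real n) * K)"
      using n by (simp add: field_simps)
    finally have R: "(\<Sum>i\<in>A. R i) = fact n * (real n - harm n) * (real (Suc n) / real n) * K"
      if "n \<noteq> 1" using that unfolding mult_cancel_left by auto
    \<comment> \<open>For \<open>n = 1\<close> the factor \<open>real n - 1\<close> cancels all information in the induction
      hypothesis, but then the remaining list is a singleton, whose innovation is 0.\<close>
    show ?thesis
    proof (cases "n = 1")
      case True
      then have "R i = 0" if "i \<in> A" for i
      proof -
        have "card (A - {i}) = 1" using Suc.prems that True by simp
        then obtain k where k: "A - {i} = {k}" by (auto simp: card_1_singleton_iff)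
        show ?thesis unfolding R_def k by (simp add: centred_def)
      qed
      then show ?thesis
        using rec True by (simp add: K_def[symmetric] harm_def numeral_2_eq_2)
    next
      case False
      have h: "harm (Suc n) = harm n + 1 / (real n + 1)"
        by (simp add: harm_Suc divide_simps add.commute)
      show ?thesis
        unfolding rec R[OF False] K_def[symmetric] h using n
        by (simp add: field_simps)
    qed
  qed
qed simp

section \<open>Passing to exchangeable variables\<close>

lemma ex_permutes_map_eq:
  assumes "is \<in> permutations_of_set A" "js \<in> permutations_of_set A"
  obtains \<pi> where "\<pi> permutes A" "map \<pi> is = js"
proof -
  note s = permutations_of_setD[OF assms(1)] and t = permutations_of_setD[OF assms(2)]
  have len: "length is = length js"
    using s t distinct_card by metis
  define \<pi> where "\<pi> x = (case map_of (zip is js) x of None \<Rightarrow> x | Some y \<Rightarrow> y)" for x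
  have nth: "\<pi> (is ! k) = js ! k" if "k < length is" for k
    using that s len by (simp add: \<pi>_def map_of_zip_nth)
  have map: "map \<pi> is = js"
    using nth len by (intro nth_equalityI) auto
  have "inj_on \<pi> A"
    using map s t distinct_map by metis
  moreover have "\<pi> ` A = A"
    using map s t by (metis set_map)
  moreover have "\<pi> x = x" if "x \<notin> A" for x
    using that s len by (simp add: \<pi>_def map_of_zip_is_None[THEN iffD2])
  ultimately have "\<pi> permutes A"
    by (intro bij_imp_permutes) (auto simp: bij_betw_def)
  then show ?thesis using map that by blast
qed

lemma exchangeable_expectation_innovations:
  assumes X: "\<And>i. i \<in> {1..N} \<Longrightarrow> X i \<in> borel_measurable M"
    and ex: "exchangeable M N X"
    and "is \<in> permutations_of_set {1..N}" "js \<in> permutations_of_set {1..N}"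
  shows "(\<integral>\<omega>. exp (dot vs (innovations (\<lambda>i. X i \<omega>) is)) \<partial>M) =
    (\<integral>\<omega>. exp (dot vs (innovations (\<lambda>i. X i \<omega>) js)) \<partial>M)"
proof -
  obtain \<pi> where \<pi>: "\<pi> permutes {1..N}" "map \<pi> is = js"
    using ex_permutes_map_eq assms(3,4) by blast
  note set_is = permutations_of_setD(1)[OF assms(3)]
  define P :: "(nat \<Rightarrow> real) measure" where "P = (\<Pi>\<^sub>M i\<in>{1..N}. borel)"
  define g where "g x = exp (dot vs (innovations x is))" for x
  have g [measurable]: "g \<in> borel_measurable P"
    unfolding g_def P_def
    by (intro borel_measurable_exp[THEN measurable_compose_rev]
        borel_measurable_dot_innovations measurable_component_singleton) (simp add: set_is)
  have X\<pi>: "X (\<pi> i) \<in> borel_measurable M" if "i \<in> {1..N}" for i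
    using X permutes_in_image[OF \<pi>(1)] that by blast
  have m: "(\<lambda>\<omega>. \<lambda>i\<in>{1..N}. X i \<omega>) \<in> measurable M P"
    "(\<lambda>\<omega>. \<lambda>i\<in>{1..N}. X (\<pi> i) \<omega>) \<in> measurable M P"
    unfolding P_def by (intro measurable_restrict X X\<pi>; assumption)+
  have g_restrict: "g (\<lambda>i\<in>{1..N}. x i) = g x" for x
    unfolding g_def by (intro arg_cong[where f = exp] arg_cong2[where f = dot] refl innovations_cong)
      (simp add: set_is)
  have "(\<integral>\<omega>. g (\<lambda>i. X i \<omega>) \<partial>M) = (\<integral>x. g x \<partial>distr M P (\<lambda>\<omega>. \<lambda>i\<in>{1..N}. X i \<omega>))"
    by (subst integral_distr[OF m(1) g]) (simp only: g_restrict)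
  also have "\<dots> = (\<integral>x. g x \<partial>distr M P (\<lambda>\<omega>. \<lambda>i\<in>{1..N}. X (\<pi> i) \<omega>))"
    using ex \<pi>(1) unfolding exchangeable_def P_def by metis
  also have "\<dots> = (\<integral>\<omega>. g (\<lambda>i. X (\<pi> i) \<omega>) \<partial>M)"
    by (subst integral_distr[OF m(2) g]) (simp only: g_restrict)
  also have "\<dots> = (\<integral>\<omega>. exp (dot vs (innovations (\<lambda>i. X i \<omega>) js)) \<partial>M)"
    unfolding \<pi>(2)[symmetric] innovations_map[OF permutes_inj[OF \<pi>(1)]] by (simp add: g_def o_def)
  finally show ?thesis by (simp add: g_def)
qed

context prob_space
begin

lemma integrable_exp_dot_innovations:
  assumes "\<And>i. i \<in> set is \<Longrightarrow> X i \<in> borel_measurable M"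
    and "\<And>i. i \<in> set is \<Longrightarrow> AE \<omega> in M. X i \<omega> \<in> {-1..1}"
  shows "integrable M (\<lambda>\<omega>. exp (dot vs (innovations (\<lambda>i. X i \<omega>) is)))"
proof (rule integrable_const_bound)
  have "AE \<omega> in M. \<forall>i\<in>set is. X i \<omega> \<in> {-1..1}"
    using assms(2) by (intro AE_finite_allI) auto
  then show "AE \<omega> in M. norm (exp (dot vs (innovations (\<lambda>i. X i \<omega>) is)))
      \<le> exp (2 * (\<Sum>v\<leftarrow>vs. \<bar>v\<bar>))"
  proof eventually_elim
    case (elim \<omega>)
    then have "\<bar>dot vs (innovations (\<lambda>i. X i \<omega>) is)\<bar> \<le> 2 * (\<Sum>v\<leftarrow>vs. \<bar>v\<bar>)"
      by (intro abs_dot_innovations_le) (auto simp: abs_le_iff minus_le_iff)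
    then show ?case by simp
  qed
qed (intro borel_measurable_exp[THEN measurable_compose_rev]
    borel_measurable_dot_innovations assms(1); assumption)

text \<open>
  By exchangeability the expectation is the same for all enumerations, so it equals its average
  over all of them, and this average is bounded pointwise.
\<close>

lemma expectation_exp_innovations_le:
  assumes X: "\<And>i. i \<in> {1..N} \<Longrightarrow> X i \<in> borel_measurable M"
    and bound: "\<And>i. i \<in> {1..N} \<Longrightarrow> AE \<omega> in M. X i \<omega> \<in> {-1..1}"
    and ex: "exchangeable M N X"
    and "is": "is \<in> permutations_of_set {1..N}" and vs: "length vs = N"
  shows "expectation (\<lambda>\<omega>. exp (dot vs (innovations (\<lambda>i. X i \<omega>) is))) \<le> exp (dot vs vs / 2)"
proof -
  let ?P = "permutations_of_set {1..N}"
  let ?h = "\<lambda>js \<omega>. exp (dot vs (innovations (\<lambda>i. X i \<omega>) js))"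
  have int: "integrable M (?h js)" if "js \<in> ?P" for js
    using X bound permutations_of_setD(1)[OF that] by (intro integrable_exp_dot_innovations) auto
  have "fact N * expectation (?h is) = (\<Sum>js\<in>?P. expectation (?h is))"
    by simp
  also have "\<dots> = (\<Sum>js\<in>?P. expectation (?h js))"
    by (intro sum.cong refl exchangeable_expectation_innovations[OF X ex "is"])
  also have "\<dots> = expectation (\<lambda>\<omega>. \<Sum>js\<in>?P. ?h js \<omega>)"
    by (rule Bochner_Integration.integral_sum[symmetric]) (rule int)
  also have "\<dots> \<le> expectation (\<lambda>\<omega>. fact N * exp (dot vs vs / 2))"
  proof (rule integral_mono_AE)
    have "AE \<omega> in M. \<forall>i\<in>{1..N}. X i \<omega> \<in> {-1..1}"
      using bound by (intro AE_finite_allI) auto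
    then show "AE \<omega> in M. (\<Sum>js\<in>?P. ?h js \<omega>) \<le> fact N * exp (dot vs vs / 2)"
    proof eventually_elim
      case (elim \<omega>)
      then show ?case
        using sum_permutations_exp_innovations_le[of "{1..N}" vs "\<lambda>i. X i \<omega>"] vs
        by (auto simp: abs_le_iff minus_le_iff)
    qed
  qed (intro Bochner_Integration.integrable_sum int integrable_const; assumption)+
  also have "\<dots> = fact N * exp (dot vs vs / 2)"
    by (simp add: prob_space)
  finally show ?thesis by simp
qed

section \<open>Weighted sums of exchangeable variables\<close>

lemma harm_less: "N \<ge> 2 \<Longrightarrow> harm N < real N"
proof (induction N rule: dec_induct)
  case base
  show ?case by (simp add: harm_def numeral_2_eq_2)
next
  case (step n)
  have "inverse (real (Suc n)) \<le> 1"
    by (simp add: inverse_eq_divide)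
  moreover have "harm (Suc n) = harm n + inverse (real (Suc n))"
    by (simp add: harm_Suc)
  ultimately show ?case using step by simp
qed

lemma one_plus_epsilon: "N \<ge> 2 \<Longrightarrow> 1 + epsilon N = (real N - 1) / (real N - harm N)"
  using harm_less[of N] by (simp add: epsilon_def field_simps)

lemma one_plus_epsilon_pos: "N \<ge> 2 \<Longrightarrow> 0 < 1 + epsilon N"
  using harm_less[of N] by (simp add: one_plus_epsilon)

lemma mean_permutations_innovations:
  assumes "N \<ge> 2"
  shows "(\<Sum>is\<in>permutations_of_set {1..N}. dot (innovations w is) (innovations x is)) / fact N =
    (\<Sum>i=1..N. centred {1..N} w i * centred {1..N} x i) / (1 + epsilon N)"
  using sum_permutations_innovations[of "{1..N}" N w x] assms harm_less[OF assms]
  by (simp add: one_plus_epsilon field_simps)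

lemma expectation_exp_weighted_sum_le:
  assumes "N \<ge> 2"
    and X: "\<And>i. i \<in> {1..N} \<Longrightarrow> X i \<in> borel_measurable M"
    and bound: "\<And>i. i \<in> {1..N} \<Longrightarrow> AE \<omega> in M. X i \<omega> \<in> {-1..1}"
    and ex: "exchangeable M N X"
  shows "integrable M (\<lambda>\<omega>. exp (\<Sum>i=1..N. w i * (X i \<omega> - sample_mean N X \<omega>)))" (is ?int)
    and "expectation (\<lambda>\<omega>. exp (\<Sum>i=1..N. w i * (X i \<omega> - sample_mean N X \<omega>)))
      \<le> exp ((\<Sum>i=1..N. (w i)\<^sup>2) * (1 + epsilon N) / 2)" (is ?le)
proof -
  define C where "C = 1 + epsilon N"
  let ?P = "permutations_of_set {1..N}"
  define F where "F \<omega> = (\<Sum>i=1..N. w i * (X i \<omega> - sample_mean N X \<omega>))" for \<omega>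
  \<comment> \<open>\<open>Y is\<close> are the summands whose average is \<open>F\<close>, and \<open>a is\<close> the bounds on their log-moments.\<close>
  define v where "v is = map ((*) C) (innovations w is)" for "is"
  define Y where "Y is \<omega> = dot (v is) (innovations (\<lambda>i. X i \<omega>) is)" for "is" \<omega>
  define a where "a is = dot (v is) (v is) / 2" for "is"
  define b where "b = (\<Sum>is\<in>?P. a is) / fact N"
  have C: "C > 0" using one_plus_epsilon_pos[OF assms(1)] by (simp add: C_def)
  have F: "F \<omega> = (\<Sum>is\<in>?P. Y is \<omega>) / fact N" for \<omega>
  proof -
    have "F \<omega> = (\<Sum>i=1..N. w i * centred {1..N} (\<lambda>i. X i \<omega>) i)"
      by (simp add: F_def centred_def sample_mean_def)
    also have "\<dots> = (\<Sum>i=1..N. centred {1..N} w i * centred {1..N} (\<lambda>i. X i \<omega>) i)"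
      by (rule sum_mult_centred) simp
    also have "\<dots> = C * ((\<Sum>is\<in>?P. dot (innovations w is) (innovations (\<lambda>i. X i \<omega>) is)) / fact N)"
      unfolding mean_permutations_innovations[OF assms(1)] C_def[symmetric] using C by simp
    finally show ?thesis
      by (simp add: Y_def v_def dot_map_mult_left sum_distrib_left)
  qed
  have int: "integrable M (\<lambda>\<omega>. exp (Y is \<omega>))" if "is \<in> ?P" for "is"
    unfolding Y_def using X bound permutations_of_setD(1)[OF that]
    by (intro integrable_exp_dot_innovations) auto
  have E: "expectation (\<lambda>\<omega>. exp (Y is \<omega>)) \<le> exp (a is)" if "is \<in> ?P" for "is"
    unfolding Y_def a_def
    using that length_finite_permutations_of_set[OF that]
    by (intro expectation_exp_innovations_le[OF X bound ex]) (auto simp: v_def)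
  \<comment> \<open>Subtracting \<open>a is\<close> first normalises all terms to expectation at most 1, so that Jensen's
    inequality alone yields the average of the \<open>a is\<close> in the exponent.\<close>
  have jensen: "exp (F \<omega> - b) \<le> (\<Sum>is\<in>?P. exp (Y is \<omega>) * exp (- a is)) / fact N" for \<omega>
  proof -
    have "exp (\<Sum>is\<in>?P. (1 / fact N) *\<^sub>R (Y is \<omega> - a is))
        \<le> (\<Sum>is\<in>?P. (1 / fact N) * exp (Y is \<omega> - a is))"
      by (rule convex_on_sum[OF _ _ exp_convex]) auto
    also have "(\<Sum>is\<in>?P. (1 / fact N) *\<^sub>R (Y is \<omega> - a is)) = F \<omega> - b"
      by (simp add: F b_def sum_subtractf diff_divide_distrib sum_divide_distrib)
    finally show ?thesis
      by (simp add: exp_diff exp_minus divide_inverse mult_ac sum_distrib_left)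
  qed
  have [measurable]: "F \<in> borel_measurable M"
    unfolding F_def sample_mean_def
    by (intro borel_measurable_sum borel_measurable_times borel_measurable_diff
        borel_measurable_divide borel_measurable_const X)
  have intr: "integrable M (\<lambda>\<omega>. (\<Sum>is\<in>?P. exp (Y is \<omega>) * exp (- a is)) / fact N)"
    by (intro integrable_divide_zero Bochner_Integration.integrable_sum integrable_mult_left impI int)
  have intF': "integrable M (\<lambda>\<omega>. exp (F \<omega> - b))"
    by (rule Bochner_Integration.integrable_bound[OF intr])
      (use jensen in \<open>auto simp: abs_of_nonneg sum_nonneg\<close>)
  then have "integrable M (\<lambda>\<omega>. exp b * exp (F \<omega> - b))"
    by (intro integrable_mult_right)
  then have intF: "integrable M (\<lambda>\<omega>. exp (F \<omega>))"
    by (simp add: exp_add[symmetric])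
  then show ?int by (simp add: F_def)
  have "expectation (\<lambda>\<omega>. exp (F \<omega> - b))
      \<le> expectation (\<lambda>\<omega>. (\<Sum>is\<in>?P. exp (Y is \<omega>) * exp (- a is)) / fact N)"
    by (rule integral_mono[OF intF' intr jensen])
  also have "\<dots> = (\<Sum>is\<in>?P. expectation (\<lambda>\<omega>. exp (Y is \<omega>)) * exp (- a is)) / fact N"
    by (simp add: Bochner_Integration.integral_sum int)
  also have "\<dots> \<le> (\<Sum>is\<in>?P. exp (a is) * exp (- a is)) / fact N"
    by (intro divide_right_mono sum_mono mult_right_mono E) auto
  also have "\<dots> = 1"
    by (simp add: exp_minus)
  finally have "expectation (\<lambda>\<omega>. exp (F \<omega>)) \<le> exp b"
    by (simp add: exp_diff)
  also have "b \<le> (\<Sum>i=1..N. (w i)\<^sup>2) * C / 2"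
  proof -
    have "b = C\<^sup>2 / 2 * ((\<Sum>is\<in>?P. dot (innovations w is) (innovations w is)) / fact N)"
      by (simp add: b_def a_def v_def dot_map_mult_self sum_distrib_left sum_divide_distrib)
    also have "\<dots> = C / 2 * (\<Sum>i=1..N. (centred {1..N} w i)\<^sup>2)"
      unfolding mean_permutations_innovations[OF assms(1)] C_def[symmetric]
      using C by (simp add: power2_eq_square)
    also have "\<dots> \<le> C / 2 * (\<Sum>i=1..N. (w i)\<^sup>2)"
      using C by (intro mult_left_mono sum_centred_square_le) auto
    finally show ?thesis by (simp add: mult.commute)
  qed
  finally show ?le by (simp add: F_def C_def)
qed

text \<open>Weights on the first \<open>n\<close> variables are extended by zero to all \<open>N\<close>.\<close>

lemma expectation_exp_partial_weighted_sum_le: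
  assumes "N \<ge> 2" "n \<le> N"
    and X: "\<And>i. i \<in> {1..N} \<Longrightarrow> X i \<in> borel_measurable M"
    and bound: "\<And>i. i \<in> {1..N} \<Longrightarrow> AE \<omega> in M. X i \<omega> \<in> {-1..1}"
    and ex: "exchangeable M N X"
  shows "integrable M (\<lambda>\<omega>. exp (t * (\<Sum>i=1..n. w i * (X i \<omega> - sample_mean N X \<omega>))))" (is ?int)
    and "expectation (\<lambda>\<omega>. exp (t * (\<Sum>i=1..n. w i * (X i \<omega> - sample_mean N X \<omega>))))
      \<le> exp (t\<^sup>2 / 2 * (L2_set w {1..n})\<^sup>2 * (1 + epsilon N))" (is ?le)
proof -
  define u where "u i = (if i \<in> {1..n} then t * w i else 0)" for i
  have sub: "{1..n} \<subseteq> {1..N}" using assms(2) by auto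
  have 1: "(\<Sum>i=1..N. u i * (X i \<omega> - sample_mean N X \<omega>)) =
      t * (\<Sum>i=1..n. w i * (X i \<omega> - sample_mean N X \<omega>))" for \<omega>
    unfolding sum_distrib_left using sub
    by (intro sum.mono_neutral_cong_right) (auto simp: u_def)
  have "(\<Sum>i=1..N. (u i)\<^sup>2) = t\<^sup>2 * (\<Sum>i=1..n. (w i)\<^sup>2)"
    unfolding sum_distrib_left using sub
    by (intro sum.mono_neutral_cong_right) (auto simp: u_def power_mult_distrib)
  also have "(\<Sum>i=1..n. (w i)\<^sup>2) = (L2_set w {1..n})\<^sup>2"
    by (simp add: L2_set_def sum_nonneg)
  finally have 2: "(\<Sum>i=1..N. (u i)\<^sup>2) = t\<^sup>2 * (L2_set w {1..n})\<^sup>2" .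
  note * = expectation_exp_weighted_sum_le[OF assms(1) X bound ex, of u]
  show ?int by (rule *(1)[unfolded 1])
  show ?le using *(2)[unfolded 1 2] by simp
qed

text \<open>
  Chernoff's method, for a random variable whose moment generating function is at most that of a
  centred Gaussian with variance \<open>s\<^sup>2\<close>.
\<close>

lemma subgaussian_tail_le:
  assumes int: "\<And>t. integrable M (\<lambda>\<omega>. exp (t * Z \<omega>))"
    and mgf: "\<And>t. expectation (\<lambda>\<omega>. exp (t * Z \<omega>)) \<le> exp (t\<^sup>2 * s\<^sup>2 / 2)"
    and "s > 0" "0 < \<delta>" "\<delta> < 1"
  shows "prob {\<omega> \<in> space M. Z \<omega> \<ge> s * sqrt (2 * ln (1 / \<delta>))} \<le> \<delta>"
proof -
  define L where "L = ln (1 / \<delta>)"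
  have L: "L > 0" using assms by (simp add: L_def)
  \<comment> \<open>The minimiser of \<open>t\<^sup>2 * s\<^sup>2 / 2 - t * (s * sqrt (2 * L))\<close>; the minimum is \<open>- L\<close>.\<close>
  define t where "t = sqrt (2 * L) / s"
  have t: "t > 0" using L assms(3) by (simp add: t_def)
  have ts: "t * s = sqrt (2 * L)" using assms(3) by (simp add: t_def)
  have set_int: "set_integrable M (space M) (\<lambda>\<omega>. exp (t * Z \<omega>))"
    unfolding set_integrable_def
    by (rule Bochner_Integration.integrable_cong[THEN iffD1, OF refl _ int[of t]]) simp
  have "prob {\<omega> \<in> space M. Z \<omega> \<ge> s * sqrt (2 * L)}
      \<le> exp (- t * (s * sqrt (2 * L))) * (\<integral>\<omega>\<in>space M. exp (t * Z \<omega>) \<partial>M)"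
    by (rule Chernoff_ineq_ge[OF t set_int]) simp
  also have "(\<integral>\<omega>\<in>space M. exp (t * Z \<omega>) \<partial>M) = expectation (\<lambda>\<omega>. exp (t * Z \<omega>))"
    by (rule set_integral_space[OF int])
  also have "exp (- t * (s * sqrt (2 * L))) * expectation (\<lambda>\<omega>. exp (t * Z \<omega>))
      \<le> exp (- t * (s * sqrt (2 * L))) * exp (t\<^sup>2 * s\<^sup>2 / 2)"
    by (intro mult_left_mono mgf) simp
  also have "\<dots> = exp (- ((t * s) * sqrt (2 * L)) + (t * s)\<^sup>2 / 2)"
    by (simp add: exp_add[symmetric] power_mult_distrib mult.assoc)
  also have "\<dots> = exp (- L)"
    unfolding ts using L by simp
  also have "\<dots> = \<delta>"
    using assms by (simp add: L_def ln_div)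
  finally show ?thesis by (simp add: L_def)
qed

end

theorem theorem4:
  fixes M :: "'a measure" and X :: "nat \<Rightarrow> 'a \<Rightarrow> real"
    and w :: "nat \<Rightarrow> real" and n N :: nat
  assumes "prob_space M"
    and "2 \<le> n" and "n \<le> N"
    and "\<And>i. i \<in> {1..N} \<Longrightarrow> X i \<in> borel_measurable M"
    and "\<And>i. i \<in> {1..N} \<Longrightarrow> AE \<omega> in M. X i \<omega> \<in> {-1..1}"
    and "exchangeable M N X"
  shows "(\<forall>t::real.
            prob_space.expectation M
              (\<lambda>\<omega>. exp (t * (\<Sum>i=1..n. w i * (X i \<omega> - sample_mean N X \<omega>))))
            \<le> exp (t\<^sup>2 / 2 * (L2_set w {1..n})\<^sup>2 * (1 + epsilon N)))
       \<and> ((\<exists>i\<in>{1..n}. w i \<noteq> 0) \<longrightarrow>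
          (\<forall>\<delta>::real. 0 < \<delta> \<and> \<delta> < 1 \<longrightarrow>
            prob_space.prob M
              {\<omega> \<in> space M. (\<Sum>i=1..n. w i * (X i \<omega> - sample_mean N X \<omega>))
                 \<ge> L2_set w {1..n} * sqrt (2 * (1 + epsilon N) * ln (1 / \<delta>))}
            \<le> \<delta>))"
proof (intro conjI impI allI)
  interpret prob_space M by fact
  have N: "N \<ge> 2" using assms(2,3) by simp
  note mgf = expectation_exp_partial_weighted_sum_le[OF N assms(3) assms(4-6), of _ w]
  show "expectation (\<lambda>\<omega>. exp (t * (\<Sum>i=1..n. w i * (X i \<omega> - sample_mean N X \<omega>))))
      \<le> exp (t\<^sup>2 / 2 * (L2_set w {1..n})\<^sup>2 * (1 + epsilon N))" for t
    by (rule mgf(2))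
  fix \<delta> :: real
  assume w: "\<exists>i\<in>{1..n}. w i \<noteq> 0" and \<delta>: "0 < \<delta> \<and> \<delta> < 1"
  define s where "s = L2_set w {1..n} * sqrt (1 + epsilon N)"
  have "L2_set w {1..n} \<noteq> 0"
    using w by (simp add: L2_set_eq_0_iff)
  then have "L2_set w {1..n} > 0"
    by (metis L2_set_nonneg order_less_le)
  then have s: "s > 0"
    using one_plus_epsilon_pos[OF N] unfolding s_def by (intro mult_pos_pos) auto
  have s2: "s\<^sup>2 = (L2_set w {1..n})\<^sup>2 * (1 + epsilon N)"
    using one_plus_epsilon_pos[OF N] by (simp add: s_def power_mult_distrib)
  have "prob {\<omega> \<in> space M. (\<Sum>i=1..n. w i * (X i \<omega> - sample_mean N X \<omega>))
      \<ge> s * sqrt (2 * ln (1 / \<delta>))} \<le> \<delta>"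
    by (rule subgaussian_tail_le[OF mgf(1) _ s]) (use mgf(2) \<delta> in \<open>auto simp: s2 mult.assoc\<close>)
  moreover have "s * sqrt (2 * ln (1 / \<delta>)) =
      L2_set w {1..n} * sqrt (2 * (1 + epsilon N) * ln (1 / \<delta>))"
    by (simp only: s_def real_sqrt_mult mult_ac)
  ultimately show "prob {\<omega> \<in> space M. (\<Sum>i=1..n. w i * (X i \<omega> - sample_mean N X \<omega>))
      \<ge> L2_set w {1..n} * sqrt (2 * (1 + epsilon N) * ln (1 / \<delta>))} \<le> \<delta>"
    by simp
qed

end
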